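(* Let $C\subseteq\mathcal{E}$ be a closed convex set with $B(x_0,R)\subseteq C$ for some $x_0\in\mathcal{E}$ and $R>0$. Let $K$ be the closure of the cone $\{(x,r)\in\mathcal{E}\times\mathbb{R}: r>0,\ x/r\in C-x_0\}$. Then $$C=\{x\in\mathcal{E}:(x-x_0,1)\in K\}.$$ Further, $K$ is closed, convex, and outer $\left(1-\frac{R}{\sqrt{1+R^2}}\right)$-smoothable.
   Context: $\mathcal{E}$ is a finite-dimensional Euclidean space with inner product $\langle\cdot,\cdot\rangle$ and induced norm; $B(x_0,R)$ is the closed ball of radius $R$ about $x_0$. $\mathcal{E}\times\mathbb{R}$ is a Euclidean space with inner product $\langle(x,\alpha),(x',\alpha')\rangle=\langle x,x'\rangle+\alpha\alpha'$. In a Euclidean space $V$: the Hausdorff distance between nonempty sets is $\mathrm{dist}(S,K)=\max\{\sup_{x\in S}\inf_{y\in K}\|x-y\|,\ \sup_{y\in K}\inf_{x\in S}\|x-y\|\}$. The normal cone of a convex set $S$ at $x\in S$ is $N_S(x)=\{\zeta:\langle\zeta,y-x\rangle\le0\ \forall y\in S\}$. A closed convex set $S$ is $\beta$-smooth if $\|\zeta-\zeta'\|\le\beta\|x-x'\|$ for all $x,x'\in S$ and all unit-norm $\zeta\in N_S(x)$, $\zeta'\in N_S(x')$. A closed convex cone $K\subseteq V$ is outer $\lambda$-smoothable if for every $\beta>0$ there is a $\beta$-smooth closed convex set $S\supseteq K$ with $\mathrm{dist}(S,K)\le\lambda/\beta$. Here these notions are applied with $V=\mathcal{E}\times\mathbb{R}$.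 *)

theory Defs
  imports "HOL-Analysis.Analysis"
begin

(* Extended-real valued, so that the distance between sets at unbounded distance
   is infinity rather than an arbitrary real number.  Meant for nonempty sets. *)
definition hausdorff_distance :: "'v::real_normed_vector set \<Rightarrow> 'v set \<Rightarrow> ereal" where
  "hausdorff_distance S K =
     max (SUP x\<in>S. INF y\<in>K. ereal (norm (x - y)))
         (SUP y\<in>K. INF x\<in>S. ereal (norm (x - y)))"

definition normal_cone :: "'v::real_inner set \<Rightarrow> 'v \<Rightarrow> 'v set" where
  "normal_cone S x = {\<zeta>. \<forall>y\<in>S. \<zeta> \<bullet> (y - x) \<le> 0}"

definition smooth_set :: "real \<Rightarrow> 'v::euclidean_space set \<Rightarrow> bool" where
  "smooth_set \<beta> S \<longleftrightarrow> closed S \<and> convex S \<and>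
     (\<forall>x\<in>S. \<forall>x'\<in>S. \<forall>\<zeta>\<in>normal_cone S x. \<forall>\<zeta>'\<in>normal_cone S x'.
        norm \<zeta> = 1 \<longrightarrow> norm \<zeta>' = 1 \<longrightarrow> norm (\<zeta> - \<zeta>') \<le> \<beta> * norm (x - x'))"

(* A closed convex cone is taken to be nonempty, equivalently to contain 0:
   the library predicate "cone" alone also admits the empty set. *)
definition outer_smoothable :: "real \<Rightarrow> 'v::euclidean_space set \<Rightarrow> bool" where
  "outer_smoothable l K \<longleftrightarrow> closed K \<and> convex K \<and> cone K \<and> K \<noteq> {} \<and>
     (\<forall>\<beta>>0. \<exists>S. smooth_set \<beta> S \<and> K \<subseteq> S \<and> hausdorff_distance S K \<le> ereal (l / \<beta>))"

(* The product type carries the inner product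
   (x, a) \<bullet> (x', a') = x \<bullet> x' + a * a' (lemma inner_prod_def). *)
definition closed_cone_over :: "'a::euclidean_space set \<Rightarrow> 'a \<Rightarrow> ('a \<times> real) set" where
  "closed_cone_over C x0 = closure {(x, r). r > 0 \<and> x /\<^sub>R r \<in> (\<lambda>c. c - x0) ` C}"

end

theory Submission
  imports Defs
begin

text \<open>
  The ball \<open>cball x0 R\<close> inside \<open>C\<close> forces \<open>K\<close> to contain the circular cone of all \<open>(y, s)\<close> with
  \<open>norm y \<le> R * s\<close>, and hence the ball of radius \<open>r = R / sqrt (1 + R\<^sup>2)\<close> about the unit vector
  \<open>e = (0, 1)\<close>, because \<open>r\<close> is the distance from \<open>e\<close> to the boundary of the circular cone.

  A closed convex set thickened by a ball of radius \<open>\<rho>\<close> is \<open>1/\<rho>\<close>-smooth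
  (\<open>smooth_set_thickening\<close>).  Thickening \<open>K\<close> by a centred ball would give a smooth set at
  distance \<open>\<rho>\<close> from \<open>K\<close>.  The gain comes from moving the ball into the cone: thicken \<open>K\<close> by
  \<open>cball (\<rho> *\<^sub>R e) \<rho>\<close>.  This ball still contains \<open>0\<close>, so the thickened set contains \<open>K\<close>; and
  the concentric ball of radius \<open>\<rho> * r\<close> lies in \<open>K\<close>, so only a shell of width \<open>\<rho> * (1 - r)\<close>
  can stick out of \<open>K\<close> (\<open>outer_smoothable_cone_containing_cball\<close>).

  The translate of \<open>C\<close> by \<open>- x0\<close> is the slice of \<open>K\<close> at height \<open>1\<close> because \<open>C\<close> is closed and
  \<open>(y, s) \<mapsto> y /\<^sub>R s\<close> is continuous near height \<open>1\<close>: taking the closure adds no point to the slice.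
\<close>

section \<open>Smoothness of thickened convex sets\<close>

text \<open>
  A unit normal \<open>\<zeta>\<close> at \<open>x = k + w\<close>, with \<open>w\<close> in the ball, can only occur when \<open>w\<close> is the point of
  the ball farthest in the direction \<open>\<zeta>\<close>, so \<open>x - \<rho> *\<^sub>R \<zeta>\<close> is a translate of a point of \<open>K\<close> at
  which \<open>\<zeta>\<close> is normal to \<open>K\<close>.  Normal cones are monotone, so
  \<open>(\<zeta> - \<zeta>') \<bullet> (x - x') \<ge> \<rho> * (norm (\<zeta> - \<zeta>'))\<^sup>2\<close>, and Cauchy-Schwarz finishes.
\<close>
lemma smooth_set_thickening:
  fixes K :: "'v::euclidean_space set"
  assumes "closed K" "convex K" "\<rho> > 0"
  shows "smooth_set (1 / \<rho>) (\<Union>k\<in>K. \<Union>w\<in>cball a \<rho>. {k + w})"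
    (is "smooth_set _ ?S")
proof -
  have unit_normal: "\<exists>k\<in>K. x = k + (a + \<rho> *\<^sub>R \<zeta>) \<and> (\<forall>y\<in>K. \<zeta> \<bullet> (y - k) \<le> 0)"
    if x: "x \<in> ?S" and \<zeta>: "\<zeta> \<in> normal_cone ?S x" and unit: "norm \<zeta> = 1" for x \<zeta>
  proof -
    obtain k w where k: "k \<in> K" and w: "w \<in> cball a \<rho>" and xkw: "x = k + w"
      using x by auto
    define u where "u = w - a"
    have u: "norm u \<le> \<rho>" and wu: "w = a + u"
      using w by (auto simp: u_def dist_norm norm_minus_commute)
    have normal: "\<zeta> \<bullet> (y - x) \<le> 0" if "y \<in> ?S" for y
      using \<zeta> that unfolding normal_cone_def by blast
    have \<zeta>\<zeta>: "\<zeta> \<bullet> \<zeta> = 1"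
      using unit by (simp add: norm_eq_1)
    have "a + \<rho> *\<^sub>R \<zeta> \<in> cball a \<rho>"
      using unit assms(3) by (simp add: dist_norm)
    then have "k + (a + \<rho> *\<^sub>R \<zeta>) \<in> ?S"
      using k by blast
    then have le: "\<rho> \<le> \<zeta> \<bullet> u"
      using normal[of "k + (a + \<rho> *\<^sub>R \<zeta>)"] \<zeta>\<zeta> by (simp add: xkw wu inner_diff_right inner_add_right)
    have "(norm (u - \<rho> *\<^sub>R \<zeta>))\<^sup>2 = (norm u)\<^sup>2 - 2 * \<rho> * (\<zeta> \<bullet> u) + \<rho>\<^sup>2"
      unfolding power2_norm_eq_inner using \<zeta>\<zeta>
      by (simp add: inner_diff_left inner_diff_right inner_commute power2_eq_square algebra_simps)
    also have "\<dots> \<le> \<rho>\<^sup>2 - 2 * \<rho> * \<rho> + \<rho>\<^sup>2"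
    proof -
      have "(norm u)\<^sup>2 \<le> \<rho>\<^sup>2" using u by (simp add: power_mono)
      moreover have "2 * \<rho> * \<rho> \<le> 2 * \<rho> * (\<zeta> \<bullet> u)" using le assms(3) by simp
      ultimately show ?thesis by linarith
    qed
    finally have "(norm (u - \<rho> *\<^sub>R \<zeta>))\<^sup>2 \<le> 0"
      by (simp add: power2_eq_square)
    then have "u = \<rho> *\<^sub>R \<zeta>"
      by simp
    moreover have "\<zeta> \<bullet> (y - k) \<le> 0" if "y \<in> K" for y
    proof -
      have "y + w \<in> ?S" using that w by blast
      then show ?thesis using normal[of "y + w"] by (simp add: xkw)
    qed
    ultimately show ?thesis
      using k xkw wu by auto
  qed
  have "norm (\<zeta> - \<zeta>') \<le> 1 / \<rho> * norm (x - x')"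
    if x: "x \<in> ?S" "\<zeta> \<in> normal_cone ?S x" "norm \<zeta> = 1"
      and x': "x' \<in> ?S" "\<zeta>' \<in> normal_cone ?S x'" "norm \<zeta>' = 1" for x x' \<zeta> \<zeta>'
  proof -
    obtain k where k: "k \<in> K" "x = k + (a + \<rho> *\<^sub>R \<zeta>)" "\<And>y. y \<in> K \<Longrightarrow> \<zeta> \<bullet> (y - k) \<le> 0"
      using unit_normal[OF x] by auto
    obtain k' where k': "k' \<in> K" "x' = k' + (a + \<rho> *\<^sub>R \<zeta>')" "\<And>y. y \<in> K \<Longrightarrow> \<zeta>' \<bullet> (y - k') \<le> 0"
      using unit_normal[OF x'] by auto
    define d where "d = \<zeta> - \<zeta>'"
    have "d \<bullet> (k - k') \<ge> 0"
      using k(3)[OF k'(1)] k'(3)[OF k(1)]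
      by (simp add: d_def inner_diff_left inner_diff_right)
    moreover have "x - x' = (k - k') + \<rho> *\<^sub>R d"
      by (simp add: k k' d_def algebra_simps)
    ultimately have "\<rho> * (norm d)\<^sup>2 \<le> d \<bullet> (x - x')"
      by (simp add: inner_add_right power2_norm_eq_inner)
    also have "\<dots> \<le> norm d * norm (x - x')"
      by (rule norm_cauchy_schwarz)
    finally have "norm d * (\<rho> * norm d) \<le> norm d * norm (x - x')"
      by (simp add: power2_eq_square algebra_simps)
    then have "\<rho> * norm d \<le> norm (x - x')"
      by (cases "d = 0") simp_all
    then show ?thesis
      using assms(3) by (simp add: d_def field_simps)
  qed
  moreover have "closed ?S"
    using closed_compact_sums[OF assms(1) compact_cball] .
  moreover have "convex ?S"
    using convex_sums[OF assms(2) convex_cball] .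
  ultimately show ?thesis
    unfolding smooth_set_def by blast
qed

section \<open>Outer smoothing of a cone with interior\<close>

lemma hausdorff_distance_superset_le:
  assumes "K \<subseteq> S" and "d \<ge> 0" and near: "\<And>x. x \<in> S \<Longrightarrow> \<exists>y\<in>K. norm (x - y) \<le> d"
  shows "hausdorff_distance S K \<le> ereal d"
proof -
  have "(INF y\<in>K. ereal (norm (x - y))) \<le> ereal d" if "x \<in> S" for x
    using near[OF that] by (auto intro: INF_lower2)
  moreover have "(INF x\<in>S. ereal (norm (x - y))) \<le> ereal d" if "y \<in> K" for y
    using assms(1,2) that by (intro INF_lower2[of y]) auto
  ultimately show ?thesis
    unfolding hausdorff_distance_def by (simp add: SUP_least)
qed

text \<open>
  With \<open>\<rho> = 1/\<beta>\<close>, the ball \<open>cball (\<rho> *\<^sub>R e) \<rho>\<close> contains \<open>0\<close>, and each of its points lies within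
  \<open>\<rho> * (1 - r)\<close> of the point of \<open>cball (\<rho> *\<^sub>R e) (\<rho> * r) \<subseteq> K\<close> obtained by shrinking
  towards the centre by the factor \<open>r\<close>.  Adding an element of \<open>K\<close> preserves both facts, because
  a convex cone is closed under addition.
\<close>
lemma outer_smoothable_cone_containing_cball:
  fixes K :: "'v::euclidean_space set"
  assumes "closed K" "convex K" "cone K"
    and "norm e = 1" "0 \<le> r" "r \<le> 1" "cball e r \<subseteq> K"
  shows "outer_smoothable (1 - r) K"
proof -
  have add: "x + y \<in> K" if "x \<in> K" "y \<in> K" for x y
    using assms(2,3) that convex_cone by blast
  have "\<exists>S. smooth_set \<beta> S \<and> K \<subseteq> S \<and> hausdorff_distance S K \<le> ereal ((1 - r) / \<beta>)"
    if "\<beta> > 0" for \<beta>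
  proof -
    define \<rho> where "\<rho> = 1 / \<beta>"
    have \<rho>: "\<rho> > 0" "1 / \<rho> = \<beta>" "(1 - r) / \<beta> = \<rho> * (1 - r)"
      using that by (auto simp: \<rho>_def)
    define S where "S = (\<Union>k\<in>K. \<Union>w\<in>cball (\<rho> *\<^sub>R e) \<rho>. {k + w})"
    have "smooth_set \<beta> S"
      using smooth_set_thickening[OF assms(1,2) \<rho>(1)] by (simp add: S_def \<rho>(2))
    moreover have sub: "K \<subseteq> S"
    proof
      fix k assume "k \<in> K"
      moreover have "0 \<in> cball (\<rho> *\<^sub>R e) \<rho>"
        using assms(4) \<rho>(1) by (simp add: dist_norm)
      moreover have "k = k + 0" by simp
      ultimately show "k \<in> S" unfolding S_def by blast
    qed
    moreover have "hausdorff_distance S K \<le> ereal (\<rho> * (1 - r))"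
    proof (rule hausdorff_distance_superset_le[OF sub])
      show "0 \<le> \<rho> * (1 - r)" using \<rho>(1) assms(6) by simp
      fix x assume "x \<in> S"
      then obtain k w where k: "k \<in> K" and w: "w \<in> cball (\<rho> *\<^sub>R e) \<rho>" and xkw: "x = k + w"
        unfolding S_def by auto
      define v where "v = w /\<^sub>R \<rho> - e"
      have wv: "w = \<rho> *\<^sub>R (e + v)"
        using \<rho>(1) by (simp add: v_def)
      have v: "norm v \<le> 1"
        using w \<rho>(1) by (simp add: wv dist_norm scaleR_add_right)
      have "r * norm v \<le> r"
        using v assms(5) by (simp add: mult_left_le)
      then have "e + r *\<^sub>R v \<in> K"
        using assms(5,7) by (intro subsetD[OF assms(7)]) (simp add: dist_norm)
      then have "k + \<rho> *\<^sub>R (e + r *\<^sub>R v) \<in> K"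
        using add[OF k] assms(3) \<rho>(1) by (simp add: cone_def)
      moreover have "x - (k + \<rho> *\<^sub>R (e + r *\<^sub>R v)) = (\<rho> * (1 - r)) *\<^sub>R v"
        by (simp add: xkw wv algebra_simps)
      then have "norm (x - (k + \<rho> *\<^sub>R (e + r *\<^sub>R v))) \<le> \<rho> * (1 - r)"
        using v \<rho>(1) assms(6) by (simp add: mult_left_le)
      ultimately show "\<exists>y\<in>K. norm (x - y) \<le> \<rho> * (1 - r)"
        by blast
    qed
    ultimately show ?thesis
      unfolding \<rho>(3) by blast
  qed
  moreover have "K \<noteq> {}"
    using assms(5,7) by auto
  ultimately show ?thesis
    unfolding outer_smoothable_def using assms(1-3) by blast
qed

section \<open>The closed cone over a convex set\<close>

lemma mem_translated_scaled_iff: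
  fixes x :: "'a::real_vector"
  shows "x /\<^sub>R r \<in> (\<lambda>c. c - x0) ` C \<longleftrightarrow> x0 + x /\<^sub>R r \<in> C"
proof
  assume "x0 + x /\<^sub>R r \<in> C"
  then show "x /\<^sub>R r \<in> (\<lambda>c. c - x0) ` C"
    by (rule rev_image_eqI) simp
qed auto

lemma closed_cone_over_altdef:
  "closed_cone_over C x0 = closure {(x, r). r > 0 \<and> x0 + x /\<^sub>R r \<in> C}"
  by (simp add: closed_cone_over_def mem_translated_scaled_iff)

lemma closed_cone_over_slice:
  assumes "closed C"
  shows "(y, 1) \<in> closed_cone_over C x0 \<longleftrightarrow> x0 + y \<in> C"
proof
  assume "(y, 1) \<in> closed_cone_over C x0"
  then obtain f where f: "\<And>n. f n \<in> {(x, r). r > 0 \<and> x0 + x /\<^sub>R r \<in> C}" and lim: "f \<longlonglongrightarrow> (y, 1)"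
    unfolding closed_cone_over_altdef closure_sequential by blast
  have "(\<lambda>n. x0 + fst (f n) /\<^sub>R snd (f n)) \<longlonglongrightarrow> x0 + y /\<^sub>R 1"
    using tendsto_fst[OF lim] tendsto_snd[OF lim] by (intro tendsto_intros) auto
  moreover have "x0 + fst (f n) /\<^sub>R snd (f n) \<in> C" for n
    using f[of n] by (simp add: case_prod_unfold)
  ultimately have "x0 + y /\<^sub>R 1 \<in> C"
    by (rule closed_sequentially[OF assms, rotated])
  then show "x0 + y \<in> C" by simp
next
  assume "x0 + y \<in> C"
  then show "(y, 1) \<in> closed_cone_over C x0"
    unfolding closed_cone_over_altdef by (intro subsetD[OF closure_subset]) simp
qed

lemma closed_closed_cone_over: "closed (closed_cone_over C x0)"
  by (simp add: closed_cone_over_def)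

text \<open>
  The direction of a combination of \<open>(x, r)\<close> and \<open>(y, s)\<close> with weights \<open>u\<close> and \<open>v\<close> is the combination
  of the directions \<open>x /\<^sub>R r\<close> and \<open>y /\<^sub>R s\<close> with weights proportional to \<open>u * r\<close> and \<open>v * s\<close>.
\<close>
lemma convex_closed_cone_over:
  assumes "convex C"
  shows "convex (closed_cone_over C x0)"
  unfolding closed_cone_over_altdef
proof (intro convex_closure convexI)
  let ?T = "{(x, r). r > 0 \<and> x0 + x /\<^sub>R r \<in> C}"
  fix p q and u v :: real
  assume p: "p \<in> ?T" and q: "q \<in> ?T" and uv: "0 \<le> u" "0 \<le> v" "u + v = 1"
  obtain x r where pxr: "p = (x, r)" and r: "r > 0" and x: "x0 + x /\<^sub>R r \<in> C"
    using p by auto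
  obtain y s where qys: "q = (y, s)" and s: "s > 0" and y: "x0 + y /\<^sub>R s \<in> C"
    using q by auto
  define t where "t = u * r + v * s"
  have t: "t > 0"
  proof (cases "u = 0")
    case True
    then show ?thesis using uv s by (simp add: t_def)
  next
    case False
    then show ?thesis using uv r s by (simp add: t_def add_pos_nonneg)
  qed
  have weights: "u * r / t + v * s / t = 1"
    using t by (simp add: t_def add_divide_distrib[symmetric])
  have "(u * r / t) *\<^sub>R (x0 + x /\<^sub>R r) + (v * s / t) *\<^sub>R (x0 + y /\<^sub>R s) \<in> C"
    using convexD[OF assms x y _ _ weights] uv r s t by simp
  also have "(u * r / t) *\<^sub>R (x0 + x /\<^sub>R r) + (v * s / t) *\<^sub>R (x0 + y /\<^sub>R s)
      = (u * r / t + v * s / t) *\<^sub>R x0 + (u *\<^sub>R x + v *\<^sub>R y) /\<^sub>R t"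
  proof -
    have "u * r / t * inverse r = inverse t * u" "v * s / t * inverse s = inverse t * v"
      using r s by (simp_all add: divide_inverse)
    then show ?thesis
      by (simp add: scaleR_add_left scaleR_add_right)
  qed
  also have "\<dots> = x0 + (u *\<^sub>R x + v *\<^sub>R y) /\<^sub>R t"
    by (simp add: weights)
  finally show "u *\<^sub>R p + v *\<^sub>R q \<in> ?T"
    using t by (simp add: pxr qys t_def)
qed

lemma cone_closed_cone_over:
  fixes C :: "'a::euclidean_space set"
  shows "cone (closed_cone_over C x0)"
proof -
  let ?T = "{(x, r). r > 0 \<and> x0 + x /\<^sub>R r \<in> C}"
  have pos: "c *\<^sub>R p \<in> closure ?T" if p: "p \<in> closure ?T" and c: "c > 0" for c p
  proof -
    have "inverse (c * r) * c = inverse r" for r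
      using c by simp
    then have direction: "(c *\<^sub>R x) /\<^sub>R (c * r) = x /\<^sub>R r" for x :: 'a and r
      by (simp only: scaleR_scaleR)
    have "(*\<^sub>R) c ` ?T \<subseteq> ?T"
    proof (rule image_subsetI)
      fix q assume "q \<in> ?T"
      then obtain x r where q: "q = (x, r)" and "r > 0" "x0 + x /\<^sub>R r \<in> C"
        by auto
      then have "c * r > 0" "x0 + (c *\<^sub>R x) /\<^sub>R (c * r) \<in> C"
        using c by (simp_all only: direction mult_pos_pos)
      then show "c *\<^sub>R q \<in> ?T"
        unfolding q scaleR_Pair real_scaleR_def mem_Collect_eq case_prod_conv by blast
    qed
    then have "closure ((*\<^sub>R) c ` ?T) \<subseteq> closure ?T"
      by (rule closure_mono)
    then show ?thesis
      using imageI[OF p, of "(*\<^sub>R) c"] unfolding closure_scaleR by (rule subsetD)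
  qed
  \<comment> \<open>Before the closure is taken, all heights are positive, so the apex is reached only as a limit.\<close>
  have "0 \<in> closure ?T" if p: "p \<in> closure ?T" for p
  proof (rule closed_sequentially[OF closed_closure])
    show "inverse (real (Suc n)) *\<^sub>R p \<in> closure ?T" for n
      using pos[OF p] by simp
    show "(\<lambda>n. inverse (real (Suc n)) *\<^sub>R p) \<longlonglongrightarrow> 0"
      using tendsto_scaleR[OF LIMSEQ_inverse_real_of_nat tendsto_const[of p]] by simp
  qed
  then have "c *\<^sub>R p \<in> closure ?T" if "p \<in> closure ?T" "c \<ge> 0" for c p
    using pos[of p c] that by (cases "c = 0") simp_all
  then show ?thesis
    unfolding cone_def closed_cone_over_altdef by blast
qed

text \<open>
  By Cauchy-Schwarz for the vectors \<open>(1, R)\<close> and \<open>(norm y, 1 - s)\<close>, a point \<open>(y, s)\<close> of the ball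
  satisfies \<open>norm y + R * (1 - s) \<le> sqrt (1 + R\<^sup>2) * (R / sqrt (1 + R\<^sup>2)) = R\<close>; that is,
  \<open>norm y \<le> R * s\<close>.
\<close>
lemma cball_subset_closed_cone_over:
  fixes C :: "'a::euclidean_space set"
  assumes "R > 0" and "cball x0 R \<subseteq> C"
  shows "cball (0, 1) (R / sqrt (1 + R\<^sup>2)) \<subseteq> closed_cone_over C x0"
proof
  fix p :: "'a \<times> real"
  assume p: "p \<in> cball (0, 1) (R / sqrt (1 + R\<^sup>2))"
  obtain y s where ys: "p = (y, s)" by (cases p)
  have pos: "1 + R\<^sup>2 > 0"
    by (simp add: add_pos_nonneg)
  have "sqrt ((norm y)\<^sup>2 + (1 - s)\<^sup>2) \<le> R / sqrt (1 + R\<^sup>2)"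
    using p by (simp add: ys dist_Pair_Pair dist_real_def)
  then have "(sqrt ((norm y)\<^sup>2 + (1 - s)\<^sup>2))\<^sup>2 \<le> (R / sqrt (1 + R\<^sup>2))\<^sup>2"
    by (rule power_mono) simp
  then have ball: "(norm y)\<^sup>2 + (1 - s)\<^sup>2 \<le> R\<^sup>2 / (1 + R\<^sup>2)"
    using pos by (simp add: power_divide)
  have "(norm y + R * (1 - s))\<^sup>2 \<le> (1 + R\<^sup>2) * ((norm y)\<^sup>2 + (1 - s)\<^sup>2)"
    using zero_le_power2[of "R * norm y - (1 - s)"] by (simp add: power2_eq_square algebra_simps)
  also have "\<dots> \<le> (1 + R\<^sup>2) * (R\<^sup>2 / (1 + R\<^sup>2))"
    using ball pos by (intro mult_left_mono) auto
  also have "\<dots> = R\<^sup>2"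
    using pos by simp
  finally have "norm y + R * (1 - s) \<le> R"
    using assms(1) by (rule power2_le_imp_le[OF _ less_imp_le])
  then have slope: "norm y \<le> R * s"
    by (simp add: algebra_simps)
  \<comment> \<open>Points of height \<open>0\<close> are at distance at least \<open>1\<close> from \<open>(0, 1)\<close>, and the radius is below \<open>1\<close>.\<close>
  have "s \<noteq> 0"
  proof
    assume "s = 0"
    then have "(norm y)\<^sup>2 + 1 \<le> R\<^sup>2 / (1 + R\<^sup>2)"
      using ball by simp
    then have "1 \<le> R\<^sup>2 / (1 + R\<^sup>2)"
      by (rule order_trans[rotated]) simp
    then show False
      using pos by (simp add: field_simps)
  qed
  moreover have "s \<ge> 0"
    using order_trans[OF norm_ge_zero slope] assms(1) by (simp add: zero_le_mult_iff)
  ultimately have s: "s > 0" by simp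
  then have "norm y / s \<le> R"
    using slope by (simp add: divide_le_eq)
  then have "x0 + y /\<^sub>R s \<in> cball x0 R"
    using s by (simp add: dist_norm divide_inverse mult.commute)
  then have "x0 + y /\<^sub>R s \<in> C"
    using assms(2) by blast
  then show "p \<in> closed_cone_over C x0"
    using s unfolding closed_cone_over_altdef ys by (intro subsetD[OF closure_subset]) simp
qed

section \<open>Slice and outer smoothability of the cone\<close>

theorem theorem5p2:
  fixes C :: "'a::euclidean_space set" and x0 :: 'a and R :: real
    and K :: "('a \<times> real) set"
  assumes "closed C" and "convex C"
    and "R > 0" and "cball x0 R \<subseteq> C"
    and "K = closed_cone_over C x0"
  shows "C = {x. (x - x0, 1) \<in> K} \<and> closed K \<and> convex K \<and>
         outer_smoothable (1 - R / sqrt (1 + R\<^sup>2)) K"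
proof -
  have K: "closed K" "convex K" "cone K"
    using assms(2,5) closed_closed_cone_over convex_closed_cone_over cone_closed_cone_over by auto
  have slice: "C = {x. (x - x0, 1) \<in> K}"
    using closed_cone_over_slice[OF assms(1)] assms(5) by auto
  have "R \<le> sqrt (1 + R\<^sup>2)"
    by (rule real_le_rsqrt) simp
  then have ratio: "0 \<le> R / sqrt (1 + R\<^sup>2)" "R / sqrt (1 + R\<^sup>2) \<le> 1"
    using assms(3) by (simp_all add: divide_le_eq add_pos_nonneg)
  have "outer_smoothable (1 - R / sqrt (1 + R\<^sup>2)) K"
    using cball_subset_closed_cone_over[OF assms(3,4)] assms(5)
    by (intro outer_smoothable_cone_containing_cball[where e = "(0, 1)"] K ratio) (auto simp: norm_Pair)
  with slice K show ?thesis by blast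
qed

end
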